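(* Let $A$ be an $n\times n$ invertible real matrix, and consider the linear time-invariant system $\dot r(t)=Ar(t)$, $r(t)\in\mathbb{R}^n$. For a solution $r(t)$ denote by $\tau(t)$ the torsion of its trajectory. Then: (1) If there exists a measurable set $E_1\subseteq\mathbb{R}^n$ of Lebesgue measure greater than $0$ such that for every solution with $r(0)\in E_1$ either $\lim_{t\to+\infty}\tau(t)\neq 0$ or $\lim_{t\to+\infty}\tau(t)$ does not exist, then the zero solution of the system is stable. (2) If there exists a measurable set $E_2\subseteq\mathbb{R}^n$ of Lebesgue measure greater than $0$ such that for every solution with $r(0)\in E_2$ one has $\lim_{t\to+\infty}\tau(t)=+\infty$, then the zero solution of the system is asymptotically stable.
   Context: The solution of $\dot r=Ar$ with initial value $r(0)$ is $r(t)=e^{tA}r(0)$, $t\in[0,+\infty)$. Stability: the zero solution $r\equiv 0$ is stable if for every $\varepsilon>0$ there is $\delta>0$ such that $\|r(0)\|<\delta$ implies $\|r(t)\|<\varepsilon$ for all $t\ge 0$, for every solution $r$. It is asymptotically stable if it is stable and there is $\tilde\delta>0$ such that $\|r(0)\|<\tilde\delta$ implies $\lim_{t\to+\infty}r(t)=0$. Torsion (the second curvature): for a smooth curve $r$ in $\mathbb{R}^n$, let $V_k(t)$ be the $k$-dimensional volume of the parallelotope spanned by $\dot r(t),\dots,r^{(k)}(t)$. Equivalently, $V_k^2(t)$ is the sum, over all $1\le i_1<\dots<i_k\le n$, of the squares of the determinants of the $k\times k$ matrices with $(p,q)$ entry $r_{i_p}^{(q)}(t)$ (so $V_k=0$ if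 $k>n$). The torsion is $$\tau(t)=\frac{V_3(t)}{V_2^2(t)}$$ when $\dot r(t),\ddot r(t)$ are linearly independent (i.e. $V_2(t)\ne0$), and by convention $\tau\equiv 0$ if $V_2\equiv 0$. (For a solution of a linear time-invariant system, $V_2$ is either identically zero or nowhere zero.) In particular $\tau\ge 0$. A limit equal to $+\infty$ counts as satisfying the condition "$\neq 0$ or does not exist"; that is, the condition says that $\tau(t)$ does not converge to $0$. *)

theory Defs
  imports "HOL-Analysis.Analysis"
begin

text \<open>Trajectories live on \<open>[0, \<infinity>)\<close>: a curve is a total function on the reals, but only its values
  at nonnegative times matter, and derivatives are taken within \<open>{0..}\<close> (one-sided at \<open>0\<close>).\<close>

definition lti_solution :: "real^'n^'n \<Rightarrow> (real \<Rightarrow> real^'n) \<Rightarrow> bool" where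
  "lti_solution A r \<longleftrightarrow>
     (\<forall>t\<ge>0. (r has_vector_derivative A *v r t) (at t within {0..}))"

definition zero_stable :: "real^'n^'n \<Rightarrow> bool" where
  "zero_stable A \<longleftrightarrow>
     (\<forall>\<epsilon>>0. \<exists>\<delta>>0. \<forall>r. lti_solution A r \<and> norm (r 0) < \<delta> \<longrightarrow> (\<forall>t\<ge>0. norm (r t) < \<epsilon>))"

definition zero_asymptotically_stable :: "real^'n^'n \<Rightarrow> bool" where
  "zero_asymptotically_stable A \<longleftrightarrow> zero_stable A \<and>
     (\<exists>\<delta>>0. \<forall>r. lti_solution A r \<and> norm (r 0) < \<delta> \<longrightarrow> (r \<longlongrightarrow> 0) at_top)"

definition curve_deriv :: "nat \<Rightarrow> (real \<Rightarrow> real^'n) \<Rightarrow> real \<Rightarrow> real^'n" where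
  "curve_deriv k r = ((\<lambda>f t. vector_derivative f (at t within {0..})) ^^ k) r"

text \<open>The \<open>k\<close>-dimensional volume of the parallelotope spanned by the \<open>k\<close> rows of \<open>u\<close>, where
  \<open>k = CARD('k)\<close>. A choice \<open>i\<^sub>1 < \<dots> < i\<^sub>k\<close> of coordinates is a strictly increasing map from \<open>'k\<close> to
  \<open>'n\<close>; none exists if \<open>k > n\<close>, and the volume is then \<open>0\<close>. On the numeral types the order starts
  at \<open>0\<close>, which is the index of the last vector (\<open>3 = 0\<close> in type \<open>3\<close>); this only permutes the rows
  of the minors and does not affect their squares.\<close>

definition parallelotope_volume ::
    "real^'n::{finite,linorder}^'k::{finite,linorder} \<Rightarrow> real" where
  "parallelotope_volume u =
     sqrt (\<Sum>i\<in>{i :: 'k \<Rightarrow> 'n. strict_mono i}. (det (\<chi> p q. u $ q $ i p))\<^sup>2)"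

definition V2 :: "(real \<Rightarrow> real^'n::{finite,linorder}) \<Rightarrow> real \<Rightarrow> real" where
  "V2 r t = parallelotope_volume (vector [curve_deriv 1 r t, curve_deriv 2 r t] :: _^2)"

definition V3 :: "(real \<Rightarrow> real^'n::{finite,linorder}) \<Rightarrow> real \<Rightarrow> real" where
  "V3 r t = parallelotope_volume
     (vector [curve_deriv 1 r t, curve_deriv 2 r t, curve_deriv 3 r t] :: _^3)"

definition torsion :: "(real \<Rightarrow> real^'n::{finite,linorder}) \<Rightarrow> real \<Rightarrow> real" where
  "torsion r t = (if V2 r t = 0 then 0 else V3 r t / (V2 r t)\<^sup>2)"

end

theory Submission
  imports Defs
    "HOL-Computational_Algebra.Polynomial_Factorial"
    "HOL-Computational_Algebra.Field_as_Ring"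
    "HOL-Computational_Algebra.Fundamental_Theorem_Algebra"
begin

text \<open>
  Write \<open>x = r'\<close>, \<open>y = r'' = A x\<close>, \<open>z = r''' = A y\<close>. The whole theorem rests on one inequality:
  \<open>\<tau> \<sqdot> |r| \<le> C\<close> along every solution, with \<open>C\<close> depending only on the invertible matrix \<open>A\<close>.
  A Pluecker relation bounds \<open>|x \<and> y \<and> z| |y|\<close> by a multiple of \<open>|x \<and> y| |y \<and> z|\<close>, and because
  \<open>y \<and> z\<close> is the image of \<open>x \<and> y\<close> under \<open>A \<and> A\<close>, its size is at most a multiple of \<open>|x \<and> y|\<close>.
  Hence \<open>V\<^sub>3 |r''| \<le> C V\<^sub>2\<^sup>2\<close>, and invertibility lets \<open>|r|\<close> replace \<open>|r''|\<close>
  (\<open>torsion_times_norm_bounded\<close>).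
  So \<open>\<tau> \<longrightarrow> 0\<close> as soon as \<open>|r| \<longrightarrow> \<infinity>\<close>, and \<open>\<tau>\<close> stays bounded as soon as \<open>|r|\<close> stays away from \<open>0\<close>.

  It remains to see that instability makes almost every solution escape to infinity, and that failure
  of asymptotic stability keeps almost every solution away from the origin. Both come from the
  adjoint system \<open>s' = A\<^sup>T s\<close> over the complex numbers: the bilinear pairing satisfies
  \<open>\<langle>s(0), r(T)\<rangle> = \<langle>s(T), r(0)\<rangle>\<close> (\<open>duality\<close>). If \<open>A\<^sup>T y = \<lambda> y\<close>, then
  \<open>|\<langle>y, r(t)\<rangle>| = e\<^bsup>t Re \<lambda>\<^esup> |\<langle>y, r(0)\<rangle>|\<close>; a Jordan chain of length two for an imaginary \<open>\<lambda>\<close>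
  gives linear growth instead. The exceptional initial values satisfy \<open>\<langle>y, r(0)\<rangle> = 0\<close> and form a
  proper subspace, a null set.

  That such \<open>y\<close> exist is the contrapositive of the spectral stability criteria
  (\<open>zero_stable_if_adjoint_spectrum\<close>,
  \<open>zero_asymptotically_stable_if_adjoint_spectrum\<close>). In place of the Jordan normal form it suffices that every complex vector is a sum of generalized eigenvectors
  (\<open>generalized_eigenvector_induct\<close>), because the solution through a generalized eigenvector is an
  explicit finite sum. Stating the criteria for \<open>A\<^sup>T\<close> makes them deliver left eigenvectors
  of \<open>A\<close> at once, and duality carries the bounds for the adjoint solutions back to all solutions of the
  original system.
\<close>

section \<open>Torsion times the norm of the solution is bounded\<close>

definition minor2 :: "real^'n \<Rightarrow> real^'n \<Rightarrow> 'n \<Rightarrow> 'n \<Rightarrow> real" where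
  "minor2 x y i j = x$i * y$j - x$j * y$i"

text \<open>In type \<open>2\<close> the numeral \<open>2\<close> denotes \<open>0\<close>, the least element.\<close>
lemma two_less_one: "(2::2) < 1"
proof -
  have "(0::2) \<le> 1" by (simp add: less_eq_bit0_def bit0.Rep_0 bit0.Rep_1)
  moreover have "(2::2) = 0" by (metis exhaust_2 zero_neq_one)
  ultimately show ?thesis by (metis order_less_le zero_neq_one)
qed

text \<open>The minors with \<open>i < j\<close> are terms of the sum defining the volume; swapping the indices only changes
  the sign.\<close>
lemma minor2_le_volume:
  fixes x y :: "real^'n::{finite,linorder}"
  shows "\<bar>minor2 x y i j\<bar> \<le> parallelotope_volume (vector [x, y] :: _^2)"
proof -
  have less: "\<bar>minor2 x y i j\<bar> \<le> parallelotope_volume (vector [x, y] :: _^2)" if "i < j" for i j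
  proof -
    \<comment> \<open>Since \<open>2 < 1\<close> in this type, the smaller index has to be the value at \<open>2\<close>.\<close>
    define f where "f p = (if p = (2::2) then i else j)" for p
    have f: "strict_mono f"
      unfolding strict_mono_def forall_2 using that two_less_one by (auto simp: f_def dest: order.asym)
    let ?d = "\<lambda>f::2 \<Rightarrow> 'n. det (\<chi> p q. (vector [x, y] :: _^2) $ q $ f p)"
    have "(minor2 x y i j)\<^sup>2 = (?d f)\<^sup>2"
      by (simp add: det_2 minor2_def f_def power2_eq_square algebra_simps)
    also have "\<dots> \<le> (\<Sum>f\<in>{f. strict_mono f}. (?d f)\<^sup>2)"
      using f by (intro member_le_sum) auto
    finally show ?thesis
      unfolding parallelotope_volume_def by (metis real_sqrt_abs real_sqrt_le_iff)
  qed
  have "\<bar>minor2 x y i j\<bar> = \<bar>minor2 x y j i\<bar>"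
    by (simp add: minor2_def abs_minus_commute)
  then show ?thesis
    using less[of i j] less[of j i]
    by (cases i j rule: linorder_cases) (auto simp: minor2_def parallelotope_volume_def sum_nonneg)
qed

text \<open>Expand \<open>y\<^sub>l\<close> times a \<open>3 \<times> 3\<close> minor of \<open>x, y, z\<close> along \<open>x\<close> and replace \<open>y\<^sub>l x\<^sub>i\<close> by
  \<open>minor2 x y i l + x\<^sub>l y\<^sub>i\<close>. The terms with \<open>x\<^sub>l\<close> add up to a determinant in which the row \<open>y\<close> occurs
  twice, so three products of \<open>2 \<times> 2\<close> minors remain.\<close>
lemma volume3_bound:
  fixes x y z :: "real^'n::{finite,linorder}"
  assumes "\<And>i j. \<bar>minor2 x y i j\<bar> \<le> a" "\<And>i j. \<bar>minor2 y z i j\<bar> \<le> b"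
  shows "parallelotope_volume (vector [x, y, z] :: _^3) * \<bar>y $ l\<bar>
           \<le> real (card {f :: 3 \<Rightarrow> 'n. strict_mono f}) * (3 * (a * b))"
proof -
  let ?d = "\<lambda>f::3 \<Rightarrow> 'n. det (\<chi> p q. (vector [x, y, z] :: _^3) $ q $ f p)"
  have "parallelotope_volume (vector [x, y, z] :: _^3) \<le> (\<Sum>f\<in>{f. strict_mono f}. \<bar>?d f\<bar>)"
    unfolding parallelotope_volume_def using L2_set_le_sum_abs[of ?d] by (simp add: L2_set_def)
  moreover have "\<bar>?d f\<bar> * \<bar>y $ l\<bar> \<le> 3 * (a * b)" for f
  proof -
    have ab: "\<bar>minor2 x y i j * minor2 y z k m\<bar> \<le> a * b" for i j k m
      using assms by (simp add: abs_mult mult_mono')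
    have "?d f * y $ l = minor2 x y (f 1) l * minor2 y z (f 2) (f 3)
        - minor2 x y (f 2) l * minor2 y z (f 1) (f 3) + minor2 x y (f 3) l * minor2 y z (f 1) (f 2)"
      by (simp add: det_3 minor2_def algebra_simps)
    then have "\<bar>?d f * y $ l\<bar> \<le> 3 * (a * b)"
      using ab[of "f 1" l "f 2" "f 3"] ab[of "f 2" l "f 1" "f 3"] ab[of "f 3" l "f 1" "f 2"]
      by linarith
    then show ?thesis by (simp add: abs_mult)
  qed
  then have "(\<Sum>f\<in>{f. strict_mono f}. \<bar>?d f\<bar>) * \<bar>y $ l\<bar> \<le> of_nat (card {f :: 3 \<Rightarrow> 'n. strict_mono f}) * (3 * (a * b))"
    unfolding sum_distrib_right by (intro sum_bounded_above) auto
  ultimately show ?thesis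
    by (meson abs_ge_zero mult_right_mono order_trans)
qed

text \<open>This is the second compound matrix of \<open>A\<close>: the minors of the images are linear combinations of the
  original minors.\<close>
lemma minor2_image:
  fixes A :: "real^'n^'n"
  assumes "\<And>i j. \<bar>minor2 x y i j\<bar> \<le> a"
  shows "\<bar>minor2 (A *v x) (A *v y) i j\<bar> \<le> (\<Sum>k\<in>UNIV. \<Sum>m\<in>UNIV. \<bar>A$i$k\<bar> * \<bar>A$j$m\<bar>) * a"
proof -
  have "minor2 (A *v x) (A *v y) i j =
      (\<Sum>k\<in>UNIV. \<Sum>m\<in>UNIV. A$i$k * x$k * (A$j$m * y$m)) - (\<Sum>m\<in>UNIV. \<Sum>k\<in>UNIV. A$j$m * x$m * (A$i$k * y$k))"
    by (simp add: minor2_def matrix_vector_mult_def sum_product)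
  also have "(\<Sum>m\<in>UNIV. \<Sum>k\<in>UNIV. A$j$m * x$m * (A$i$k * y$k)) = (\<Sum>k\<in>UNIV. \<Sum>m\<in>UNIV. A$j$m * x$m * (A$i$k * y$k))"
    by (rule sum.swap)
  finally have "minor2 (A *v x) (A *v y) i j = (\<Sum>k\<in>UNIV. \<Sum>m\<in>UNIV. A$i$k * A$j$m * minor2 x y k m)"
    by (simp add: minor2_def sum_subtractf algebra_simps)
  also have "\<bar>\<dots>\<bar> \<le> (\<Sum>k\<in>UNIV. \<Sum>m\<in>UNIV. \<bar>A$i$k\<bar> * \<bar>A$j$m\<bar> * a)"
    by (rule order_trans[OF sum_abs] sum_mono)+ (auto simp: abs_mult intro!: mult_left_mono assms)
  finally show ?thesis
    by (simp add: sum_distrib_right)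
qed

lemma curve_deriv_solution:
  assumes "lti_solution A r" "t \<ge> 0"
  shows "curve_deriv k r t = ((*v) A ^^ k) (r t)"
  using assms(2)
proof (induction k arbitrary: t)
  case 0
  then show ?case by (simp add: curve_deriv_def)
next
  case (Suc k)
  have lin: "bounded_linear ((*v) A ^^ k)"
    by (induction k) (auto simp: id_def o_def bounded_linear_ident intro: bounded_linear_compose[OF matrix_vector_mul_bounded_linear])
  have "((\<lambda>t. ((*v) A ^^ k) (r t)) has_vector_derivative ((*v) A ^^ k) (A *v r t)) (at t within {0..})"
    using assms(1) Suc.prems unfolding lti_solution_def
    by (intro bounded_linear.has_vector_derivative[OF lin]) auto
  then have "(curve_deriv k r has_vector_derivative ((*v) A ^^ k) (A *v r t)) (at t within {0..})"
    by (rule has_vector_derivative_transform[rotated 2]) (use Suc in auto)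
  moreover have "at t within {0..} \<noteq> bot"
    using Suc.prems 
    by (auto simp: trivial_limit_within intro!: connected_imp_perfect connected_Ici)
      (metis atLeast_iff not_less singletonD lt_ex gt_ex order_less_imp_le)
  ultimately show ?case
    by (simp add: curve_deriv_def vector_derivative_within funpow_swap1)
qed

lemma torsion_nonneg: "torsion r t \<ge> 0"
  by (simp add: torsion_def V3_def parallelotope_volume_def sum_nonneg)

text \<open>With \<open>x = r'\<close>, \<open>y = r''\<close>, \<open>z = r'''\<close> the minors of \<open>x, y\<close> are at most \<open>V\<^sub>2\<close>. Those of \<open>y, z\<close> are
  at most a constant times \<open>V\<^sub>2\<close>, since \<open>y = A x\<close> and \<open>z = A y\<close>. So \<open>volume3_bound\<close> bounds
  \<open>V\<^sub>3 |r''|\<close> by a multiple of \<open>V\<^sub>2\<^sup>2\<close>.\<close>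
lemma torsion_times_acceleration_bounded:
  fixes A :: "real^'n::{finite,linorder}^'n::{finite,linorder}"
  obtains C where "\<And>r t. lti_solution A r \<Longrightarrow> t \<ge> 0 \<Longrightarrow> torsion r t * norm (A *v (A *v r t)) \<le> C"
proof -
  define N where "N = (\<Sum>i\<in>UNIV. \<Sum>k\<in>UNIV. \<bar>A$i$k\<bar>)"
  define c where "c = real (card {f :: 3 \<Rightarrow> 'n. strict_mono f}) * (3 * N\<^sup>2)"
  have row: "(\<Sum>k\<in>UNIV. \<bar>A$i$k\<bar>) \<le> N" for i
    unfolding N_def by (rule member_le_sum) (auto intro: sum_nonneg)
  have "N \<ge> 0" unfolding N_def by (intro sum_nonneg) auto
  have "torsion r t * norm (A *v (A *v r t)) \<le> real CARD('n) * c"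
    if r: "lti_solution A r" and t: "t \<ge> 0" for r t
  proof -
    define x where "x = A *v r t"
    define y where "y = A *v x"
    define z where "z = A *v y"
    have V2: "V2 r t = parallelotope_volume (vector [x, y] :: _^2)"
      and V3: "V3 r t = parallelotope_volume (vector [x, y, z] :: _^3)"
      by (simp_all add: V2_def V3_def curve_deriv_solution[OF r t] x_def y_def z_def eval_nat_numeral)
    have xy: "\<bar>minor2 x y i j\<bar> \<le> V2 r t" for i j
      unfolding V2 by (rule minor2_le_volume)
    have "V2 r t \<ge> 0" by (rule order_trans[OF abs_ge_zero xy])
    have yz: "\<bar>minor2 y z i j\<bar> \<le> N\<^sup>2 * V2 r t" for i j
    proof -
      have "\<bar>minor2 y z i j\<bar> \<le> (\<Sum>k\<in>UNIV. \<Sum>m\<in>UNIV. \<bar>A$i$k\<bar> * \<bar>A$j$m\<bar>) * V2 r t"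
        using minor2_image[OF xy, of A i j] by (simp add: y_def z_def)
      also have "\<dots> \<le> N\<^sup>2 * V2 r t"
        unfolding sum_product[symmetric] power2_eq_square using row \<open>N \<ge> 0\<close> \<open>V2 r t \<ge> 0\<close>
        by (intro mult_right_mono mult_mono) (auto intro: sum_nonneg)
      finally show ?thesis .
    qed
    have comp: "torsion r t * \<bar>y $ l\<bar> \<le> c" for l
    proof (cases "V2 r t = 0")
      case False
      have "V3 r t * \<bar>y $ l\<bar> \<le> c * (V2 r t)\<^sup>2"
        using volume3_bound[OF xy yz, of l] by (simp add: V3 c_def power2_eq_square ac_simps)
      then show ?thesis
        using False \<open>V2 r t \<ge> 0\<close> by (simp add: torsion_def divide_le_eq)
    qed (simp add: torsion_def c_def)
    have "torsion r t * norm y \<le> torsion r t * (\<Sum>l\<in>UNIV. \<bar>y $ l\<bar>)"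
      by (intro mult_left_mono norm_le_l1_cart torsion_nonneg)
    also have "\<dots> \<le> real CARD('n) * c"
      unfolding sum_distrib_left using comp by (rule sum_bounded_above)
    finally show ?thesis by (simp add: y_def x_def)
  qed
  then show thesis by (rule that)
qed

lemma torsion_times_norm_bounded:
  fixes A :: "real^'n::{finite,linorder}^'n::{finite,linorder}"
  assumes "invertible A"
  obtains C where "\<And>r t. lti_solution A r \<Longrightarrow> t \<ge> 0 \<Longrightarrow> torsion r t * norm (r t) \<le> C"
proof -
  obtain B where B: "B ** A = mat 1"
    using assms unfolding invertible_def by blast
  obtain C where C: "\<And>r t. lti_solution A r \<Longrightarrow> t \<ge> 0 \<Longrightarrow> torsion r t * norm (A *v (A *v r t)) \<le> C"
    using torsion_times_acceleration_bounded[of A] by blast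
  obtain K where K: "K > 0" "\<And>x. norm ((B ** B) *v x) \<le> norm x * K"
    using bounded_linear.pos_bounded[OF matrix_vector_mul_bounded_linear] by metis
  have "torsion r t * norm (r t) \<le> C * K" if "lti_solution A r" "t \<ge> 0" for r t
  proof -
    have "B *v (A *v x) = x" for x
      by (simp add: matrix_vector_mul_assoc B)
    then have "r t = (B ** B) *v (A *v (A *v r t))"
      by (simp flip: matrix_vector_mul_assoc)
    then have "norm (r t) \<le> norm (A *v (A *v r t)) * K"
      using K(2) by metis
    then have "torsion r t * norm (r t) \<le> torsion r t * (norm (A *v (A *v r t)) * K)"
      by (intro mult_left_mono torsion_nonneg)
    also have "\<dots> \<le> C * K"
      using C[OF that] K(1) by (simp flip: mult.assoc add: mult_right_mono)
    finally show ?thesis .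
  qed
  then show thesis by (rule that)
qed

section \<open>Generalized eigenvectors span\<close>

text \<open>The Horner scheme for \<open>p(M) v\<close>. The operation \<open>*\<close> multiplies matrices entrywise, so \<open>p(M)\<close> is not an
  evaluation of \<open>p\<close> in a ring of matrices.\<close>
definition poly_act :: "complex^'n^'n \<Rightarrow> complex poly \<Rightarrow> complex^'n \<Rightarrow> complex^'n" where
  "poly_act M p v = fold_coeffs (\<lambda>a w. a *s v + M *v w) p 0"

lemma poly_act_0 [simp]: "poly_act M 0 v = 0"
  by (simp add: poly_act_def)

lemma poly_act_pCons [simp]: "poly_act M (pCons a p) v = a *s v + M *v poly_act M p v"
  by (cases "a = 0 \<and> p = 0") (auto simp: poly_act_def)

lemma poly_act_add: "poly_act M (p + q) v = poly_act M p v + poly_act M q v"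
  by (induction p q rule: poly_induct2)
     (auto simp: matrix_vector_right_distrib vec.scale_left_distrib)

lemma poly_act_smult: "poly_act M (smult c p) v = c *s poly_act M p v"
  by (induction p) (auto simp: vec.scale_right_distrib vec.scale)

lemma poly_act_mult: "poly_act M (p * q) v = poly_act M p (poly_act M q v)"
  by (induction p) (auto simp: poly_act_add poly_act_smult)

lemma poly_act_sum: "poly_act M (sum f I) v = (\<Sum>i\<in>I. poly_act M (f i) v)"
  by (induction I rule: infinite_finite_induct) (auto simp: poly_act_add)

lemma poly_act_zero_vec [simp]: "poly_act M p 0 = 0"
  by (induction p) auto

lemma poly_act_monom: "poly_act M (monom a i) v = a *s ((*v) M ^^ i) v"
  by (induction i) (auto simp: monom_0 monom_Suc vec.scale)

definition shifted :: "complex^'n^'n \<Rightarrow> complex \<Rightarrow> complex^'n \<Rightarrow> complex^'n" where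
  "shifted M l v = M *v v - l *s v"

lemma poly_act_root_power: "poly_act M ([:-l, 1:] ^ m) v = (shifted M l ^^ m) v"
proof (induction m)
  case (Suc m)
  then show ?case
    by (simp only: power_Suc poly_act_mult) (simp add: shifted_def vec.scale_minus_left)
qed (simp add: one_pCons)

text \<open>The \<open>n + 1\<close> vectors \<open>v, M v, \<dots>, M\<^sup>n v\<close> cannot be linearly independent. If two of them coincide,
  the set they form may be independent, and then the difference of two monomials annihilates \<open>v\<close>.\<close>
lemma annihilating_polynomial:
  fixes M :: "complex^'n^'n"
  obtains p where "p \<noteq> 0" "poly_act M p v = 0"
proof -
  let ?f = "\<lambda>i. ((*v) M ^^ i) v"
  show thesis
  proof (cases "inj_on ?f {..CARD('n)}")
    case True
    then have "card (?f ` {..CARD('n)}) = Suc CARD('n)"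
      by (simp add: card_image)
    then have "vec.dependent (?f ` {..CARD('n)})"
      using vec.dim_subset_UNIV[of "?f ` {..CARD('n)}"]
      by (intro vec.dependent_biggerset_general) (auto simp: vec.dimension_def card_cart_basis)
    then obtain u w where u: "w \<in> ?f ` {..CARD('n)}" "u w \<noteq> 0"
        "(\<Sum>w\<in>?f ` {..CARD('n)}. u w *s w) = 0"
      by (subst (asm) vec.dependent_finite) auto
    then obtain i where i: "i \<le> CARD('n)" "u (?f i) \<noteq> 0"
      by auto
    define p where "p = (\<Sum>i\<le>CARD('n). monom (u (?f i)) i)"
    have "coeff p i \<noteq> 0"
      using i by (simp add: p_def coeff_sum)
    then have "p \<noteq> 0" by auto
    moreover have "poly_act M p v = 0"
      using u(3) by (simp add: p_def poly_act_sum poly_act_monom sum.reindex[OF True])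
    ultimately show ?thesis by (rule that)
  next
    case False
    then obtain i j where ij: "i \<noteq> j" "?f i = ?f j"
      by (auto simp: inj_on_def)
    have "coeff (monom 1 i + monom (-1) j :: complex poly) i \<noteq> 0"
      using ij by simp
    then have "(monom 1 i + monom (-1) j :: complex poly) \<noteq> 0"
      by (metis coeff_0)
    moreover have "poly_act M (monom 1 i + monom (-1) j) v = 0"
      using ij by (simp add: poly_act_add poly_act_monom vec.scale_minus_left)
    ultimately show ?thesis by (rule that)
  qed
qed

text \<open>Primary decomposition, one root at a time: split \<open>p = (x - l)\<^sup>m q\<close> with \<open>q(l) \<noteq> 0\<close>. A Bezout
  identity \<open>a (x - l)\<^sup>m + b q = 1\<close> writes \<open>v\<close> as the sum of a vector annihilated by \<open>q\<close>, which has
  smaller degree, and a generalized eigenvector for \<open>l\<close>.\<close>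
lemma sum_of_generalized_eigenvectors_aux:
  fixes M :: "complex^'n^'n"
  assumes gen: "\<And>l m w. (shifted M l ^^ m) w = 0 \<Longrightarrow> P w"
    and add: "\<And>u w. P u \<Longrightarrow> P w \<Longrightarrow> P (u + w)"
  shows "p \<noteq> 0 \<Longrightarrow> poly_act M p v = 0 \<Longrightarrow> P v"
proof (induction "degree p" arbitrary: p v rule: less_induct)
  case less
  show ?case
  proof (cases "degree p = 0")
    case True
    then obtain c where "p = [:c:]" by (auto elim: degree_eq_zeroE)
    then have "v = 0" using less.prems by simp
    then show ?thesis using gen[of 0 0 v] by simp
  next
    case False
    then obtain l where l: "poly p l = 0"
      using fundamental_theorem_of_algebra[of p] by (auto simp: constant_degree)
    define m where "m = order l p"
    obtain q where q: "p = [:-l, 1:] ^ m * q" "\<not> [:-l, 1:] dvd q"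
      using order_decomp[OF less.prems(1)] m_def by blast
    have "m > 0"
      using l less.prems(1) order_root m_def by blast
    have "q \<noteq> 0" using q less.prems(1) by auto
    then have deg: "degree q < degree p"
      using \<open>m > 0\<close> by (simp add: q(1) degree_mult_eq degree_power_eq)
    have "prime_elem [:-l, 1:]"
      by (simp add: prime_elem_linear_field_poly)
    then have cop: "coprime ([:-l, 1:] ^ m) q"
      using q(2) by (simp add: prime_elem_imp_coprime coprime_power_left_iff)
    obtain a b where ab: "a * [:-l, 1:] ^ m + b * q = 1"
      using bezout_coefficients_fst_snd[of "[:-l, 1:] ^ m" q] cop
      by (metis coprime_imp_gcd_eq_1)
    let ?u = "poly_act M (a * [:-l, 1:] ^ m) v" and ?w = "poly_act M (b * q) v"
    have "poly_act M q ?u = poly_act M (a * p) v"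
      unfolding q(1) poly_act_mult[symmetric] by (simp add: ac_simps)
    then have "poly_act M q ?u = 0"
      using less.prems by (simp add: poly_act_mult)
    then have "P ?u"
      using less.hyps[OF deg \<open>q \<noteq> 0\<close>] by blast
    have "poly_act M ([:-l, 1:] ^ m) ?w = poly_act M (b * p) v"
      unfolding q(1) poly_act_mult[symmetric] by (simp add: ac_simps)
    then have "poly_act M ([:-l, 1:] ^ m) ?w = 0"
      using less.prems by (simp add: poly_act_mult)
    then have "P ?w"
      using gen poly_act_root_power by metis
    have "?u + ?w = poly_act M 1 v"
      unfolding ab[symmetric] by (simp add: poly_act_add)
    also have "\<dots> = v"
      by (simp add: one_pCons)
    finally show ?thesis
      using add[OF \<open>P ?u\<close> \<open>P ?w\<close>] by simp
  qed
qed

text \<open>An induction rule that stands in for the Jordan normal form: a property closed under addition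
  needs to be verified only for generalized eigenvectors.\<close>
lemma generalized_eigenvector_induct:
  fixes M :: "complex^'n^'n"
  assumes "\<And>l m w. (shifted M l ^^ m) w = 0 \<Longrightarrow> P w"
    and "\<And>u w. P u \<Longrightarrow> P w \<Longrightarrow> P (u + w)"
  shows "P v"
proof -
  obtain p where "p \<noteq> 0" "poly_act M p v = 0"
    by (rule annihilating_polynomial)
  then show ?thesis
    using sum_of_generalized_eigenvectors_aux[of M P p v] assms by blast
qed

section \<open>Solutions through generalized eigenvectors\<close>

text \<open>Derivatives are taken entrywise, so that all calculus below is scalar.\<close>
definition complex_solution :: "complex^'n^'n \<Rightarrow> (real \<Rightarrow> complex^'n) \<Rightarrow> bool" where
  "complex_solution M s \<longleftrightarrow>
     (\<forall>t j. ((\<lambda>t. s t $ j) has_vector_derivative (M *v s t) $ j) (at t))"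

lemma complex_solution_add:
  "complex_solution M s \<Longrightarrow> complex_solution M s' \<Longrightarrow> complex_solution M (\<lambda>t. s t + s' t)"
  by (auto simp: complex_solution_def matrix_vector_right_distrib intro!: has_vector_derivative_add)

text \<open>If \<open>(M - l)\<^sup>m w = 0\<close>, this is \<open>e\<^bsup>tM\<^esup> w = e\<^bsup>tl\<^esup> e\<^bsup>t(M - l)\<^esup> w\<close>: the second exponential series
  stops before the term of index \<open>m\<close>.\<close>
definition jordan_orbit :: "complex^'n^'n \<Rightarrow> complex \<Rightarrow> nat \<Rightarrow> complex^'n \<Rightarrow> real \<Rightarrow> complex^'n" where
  "jordan_orbit M l m w t =
     exp (l * of_real t) *s (\<Sum>k<m. (of_real t ^ k / fact k) *s (shifted M l ^^ k) w)"

lemma jordan_orbit_0 [simp]: "jordan_orbit M l (Suc m) w 0 = w"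
proof -
  have "(\<Sum>k<Suc m. (0 ^ k / fact k :: complex) *s (shifted M l ^^ k) w)
      = (\<Sum>k<Suc m. if k = 0 then w else 0)"
    by (intro sum.cong) auto
  then show ?thesis
    by (simp add: jordan_orbit_def del: sum.lessThan_Suc)
qed

text \<open>By the product rule the derivative is \<open>l s + (M - l) s\<close>: differentiating the polynomial factor
  shifts its coefficients by one, exactly as applying \<open>M - l\<close> does, up to a last term that contains
  \<open>(M - l)\<^sup>m w = 0\<close>.\<close>
lemma complex_solution_jordan_orbit:
  assumes "(shifted M l ^^ m) w = 0"
  shows "complex_solution M (jordan_orbit M l m w)"
  unfolding complex_solution_def
proof (intro allI)
  fix t :: real and j
  let ?N = "\<lambda>k. (shifted M l ^^ k) w"
  let ?c = "\<lambda>k. of_real t ^ k / fact k :: complex"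
  let ?S = "\<Sum>k<m. ?c k *s ?N k"
  have c: "((\<lambda>t. of_real t ^ k / fact k :: complex) has_vector_derivative
      (case k of 0 \<Rightarrow> 0 | Suc i \<Rightarrow> ?c i)) (at t)" for k
  proof -
    have "((\<lambda>z. z ^ k / fact k :: complex) has_field_derivative
        (case k of 0 \<Rightarrow> 0 | Suc i \<Rightarrow> ?c i)) (at (of_real t))"
    proof (cases k)
      case (Suc i)
      have "((\<lambda>z. z ^ Suc i) has_field_derivative of_nat (Suc i) * of_real t ^ i) (at (complex_of_real t))"
        using DERIV_power_Suc[OF DERIV_ident, of i "complex_of_real t" UNIV] by simp
      from DERIV_cdivide[OF this, of "fact (Suc i)"] show ?thesis
        by (simp add: Suc fact_Suc del: of_nat_Suc power_Suc)
    qed simp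
    from has_vector_derivative_real_field[OF this] show ?thesis by simp
  qed
  have S: "((\<lambda>t. \<Sum>k<m. of_real t ^ k / fact k * ?N k $ j) has_vector_derivative
      (\<Sum>k<m. (case k of 0 \<Rightarrow> 0 | Suc i \<Rightarrow> ?c i) * ?N k $ j)) (at t)"
    by (intro has_vector_derivative_sum has_vector_derivative_mult_left c)
  have "(\<Sum>k<m. (case k of 0 \<Rightarrow> 0 | Suc i \<Rightarrow> ?c i) * ?N k $ j)
      = (\<Sum>k<m. ?c k * ?N (Suc k) $ j)"
  proof (cases m)
    case (Suc n)
    have "(\<Sum>k<Suc n. (case k of 0 \<Rightarrow> 0 | Suc i \<Rightarrow> ?c i) * ?N k $ j) = (\<Sum>k<n. ?c k * ?N (Suc k) $ j)"
      unfolding sum.lessThan_Suc_shift by simp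
    also have "\<dots> = (\<Sum>k<Suc n. ?c k * ?N (Suc k) $ j)"
      using assms unfolding Suc by (simp del: funpow.simps)
    finally show ?thesis unfolding Suc .
  qed simp
  note S = S[unfolded this]
  have "((\<lambda>z. exp (l * z)) has_field_derivative l * exp (l * of_real t)) (at (of_real t))"
    by (auto intro!: derivative_eq_intros)
  from has_vector_derivative_real_field[OF this]
  have E: "((\<lambda>t. exp (l * of_real t)) has_vector_derivative l * exp (l * of_real t)) (at t)"
    by simp
  have "M *v jordan_orbit M l m w t
      = exp (l * of_real t) *s (\<Sum>k<m. ?c k *s (M *v ?N k))"
    by (simp add: jordan_orbit_def vec.scale vec.sum)
  also have "\<dots> = exp (l * of_real t) *s (\<Sum>k<m. ?c k *s (l *s ?N k + ?N (Suc k)))"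
    by (simp add: shifted_def)
  finally have D: "(M *v jordan_orbit M l m w t) $ j
      = exp (l * of_real t) * (\<Sum>k<m. ?c k * ?N (Suc k) $ j)
        + l * exp (l * of_real t) * (\<Sum>k<m. ?c k * ?N k $ j)"
    by (simp add: sum.distrib sum_distrib_left algebra_simps del: funpow.simps)
  show "((\<lambda>t. jordan_orbit M l m w t $ j) has_vector_derivative (M *v jordan_orbit M l m w t) $ j) (at t)"
    unfolding D using has_vector_derivative_mult[OF E S]
    by (simp add: jordan_orbit_def del: funpow.simps)
qed

lemma complex_solution_through:
  obtains s where "complex_solution M s" "s 0 = v"
proof -
  have "\<exists>s. complex_solution M s \<and> s 0 = v"
  proof (induction v rule: generalized_eigenvector_induct[where M = M])
    case (1 l m w)
    then have "(shifted M l ^^ Suc m) w = 0"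
      by (simp add: shifted_def)
    then show ?case
      using complex_solution_jordan_orbit jordan_orbit_0 by blast
  next
    case (2 u w)
    then obtain s s' where "complex_solution M s" "s 0 = u" "complex_solution M s'" "s' 0 = w"
      by blast
    then show ?case
      by (intro exI[of _ "\<lambda>t. s t + s' t"]) (simp add: complex_solution_add)
  qed
  then show thesis using that by blast
qed

text \<open>The entrywise real part of a complex solution of a real system is again a solution.\<close>
lemma lti_solution_through:
  fixes A :: "real^'n^'n"
  obtains r where "lti_solution A r" "r 0 = x"
proof -
  obtain s where s: "complex_solution (\<chi> i j. complex_of_real (A$i$j)) s" "s 0 = (\<chi> i. complex_of_real (x$i))"
    by (rule complex_solution_through)
  define r where "r t = (\<chi> i. Re (s t $ i))" for t
  have "(r has_vector_derivative A *v r t) (at t within {0..})" for t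
  proof -
    have "((\<lambda>t. Re (s t $ i)) has_vector_derivative
            Re (((\<chi> i j. complex_of_real (A$i$j)) *v s t) $ i)) (at t)" for i
      using s(1) unfolding complex_solution_def
      by (intro bounded_linear.has_vector_derivative[OF bounded_linear_Re]) auto
    moreover have "Re (((\<chi> i j. complex_of_real (A$i$j)) *v s t) $ i) = (A *v r t) $ i" for i
      by (simp add: matrix_vector_mult_def r_def)
    ultimately have "((\<lambda>t. r t $ i) has_vector_derivative (A *v r t) $ i) (at t)" for i
      by (simp add: r_def)
    then have "(r has_vector_derivative A *v r t) (at t)"
      unfolding has_vector_derivative_def
      by (subst has_derivative_componentwise_within) 
        (auto simp: Basis_vec_def inner_axis)
    then show ?thesis
      by (rule has_vector_derivative_at_within)
  qed
  then have "lti_solution A r"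
    by (simp add: lti_solution_def)
  moreover have "r 0 = x"
    by (simp add: r_def s(2) vec_eq_iff)
  ultimately show thesis by (rule that)
qed

lemma exp_decay:
  assumes "a < 0"
  shows "((\<lambda>t. exp (a * t) * t ^ k) \<longlongrightarrow> (0::real)) at_top"
proof -
  have "filterlim (\<lambda>t. - a * t) at_top at_top"
    using assms by (intro filterlim_tendsto_pos_mult_at_top[OF tendsto_const] filterlim_ident) auto
  from filterlim_compose[OF tendsto_power_div_exp_0 this]
  have "((\<lambda>t. (- a * t) ^ k / exp (- a * t) * (1 / (- a) ^ k)) \<longlongrightarrow> 0) at_top"
    by (rule tendsto_mult_left_zero)
  moreover have "(- a * t) ^ k / exp (- a * t) * (1 / (- a) ^ k) = exp (a * t) * t ^ k" for t
    using assms by (simp add: power_mult_distrib[of "-a" t, simplified] exp_minus field_simps)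
  ultimately show ?thesis by simp
qed

lemma bounded_on_halfline:
  fixes f :: "real \<Rightarrow> complex"
  assumes "continuous_on UNIV f" "(f \<longlongrightarrow> 0) at_top"
  shows "bounded (f ` {0..})"
proof -
  have "\<forall>\<^sub>F t in at_top. norm (f t) < 1"
    using assms(2) by (auto dest: tendstoD[of _ _ _ 1])
  then obtain T where T: "\<And>t. t \<ge> T \<Longrightarrow> norm (f t) < 1"
    by (auto simp: eventually_at_top_linorder)
  have "bounded (f ` {0..T})"
    using assms(1) by (intro compact_imp_bounded compact_continuous_image) (auto intro: continuous_on_subset)
  moreover have "bounded (f ` {T..})"
    using T by (auto simp: bounded_iff intro!: exI[of _ 1] less_imp_le)
  ultimately have "bounded (f ` {0..T} \<union> f ` {T..})"
    by simp
  then show ?thesis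
    by (rule bounded_subset) force
qed

lemma jordan_orbit_tendsto_0:
  assumes "Re l < 0"
  shows "((\<lambda>t. jordan_orbit M l m w t $ j) \<longlongrightarrow> 0) at_top"
proof -
  have "((\<lambda>t. exp (l * of_real t) * (of_real t ^ k / fact k * (shifted M l ^^ k) w $ j)) \<longlongrightarrow> 0) at_top" for k
  proof (rule tendsto_norm_zero_cancel)
    have "((\<lambda>t. (exp (Re l * t) * t ^ k) * (norm ((shifted M l ^^ k) w $ j) / fact k)) \<longlongrightarrow> 0) at_top"
      using exp_decay[OF assms] by (rule tendsto_mult_left_zero)
    moreover have "\<forall>\<^sub>F t in at_top. exp (Re l * t) * t ^ k * (norm ((shifted M l ^^ k) w $ j) / fact k)
        = norm (exp (l * of_real t) * (of_real t ^ k / fact k * (shifted M l ^^ k) w $ j))"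
      using eventually_ge_at_top[of 0]
      by eventually_elim (simp add: norm_mult norm_divide norm_power)
    ultimately show "((\<lambda>t. norm (exp (l * of_real t) * (of_real t ^ k / fact k * (shifted M l ^^ k) w $ j))) \<longlongrightarrow> 0) at_top"
      by (rule Lim_transform_eventually)
  qed
  then have "((\<lambda>t. \<Sum>k<m. exp (l * of_real t) * (of_real t ^ k / fact k * (shifted M l ^^ k) w $ j)) \<longlongrightarrow> 0) at_top"
    by (rule tendsto_null_sum)
  then show ?thesis
    by (simp add: jordan_orbit_def sum_distrib_left)
qed

lemma eigenvector_of_generalized:
  assumes "(shifted M l ^^ m) w = 0" "w \<noteq> 0"
  obtains y where "y \<noteq> 0" "shifted M l y = 0"
  using assms
  by (induction m) auto

lemma decaying_solution:
  fixes M :: "complex^'n^'n"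
  assumes eig: "\<And>l y. y \<noteq> 0 \<Longrightarrow> shifted M l y = 0 \<Longrightarrow> Re l < 0"
  shows "\<exists>s. complex_solution M s \<and> s 0 = v \<and> (\<forall>j. ((\<lambda>t. s t $ j) \<longlongrightarrow> 0) at_top)"
proof (induction v rule: generalized_eigenvector_induct[where M = M])
  case (1 l m w)
  show ?case
  proof (cases "w = 0")
    case True
    then show ?thesis
      by (intro exI[of _ "\<lambda>_. 0"]) (simp add: complex_solution_def)
  next
    case False
    then have "Re l < 0"
      using eig eigenvector_of_generalized[OF 1] by blast
    moreover have "(shifted M l ^^ Suc m) w = 0"
      using 1 by (simp add: shifted_def)
    ultimately show ?thesis
      using complex_solution_jordan_orbit jordan_orbit_tendsto_0 jordan_orbit_0 by metis
  qed
next
  case (2 u w)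
  then obtain s s' where s: "complex_solution M s" "s 0 = u" "complex_solution M s'" "s' 0 = w"
      "\<forall>j. ((\<lambda>t. s t $ j) \<longlongrightarrow> 0) at_top" "\<forall>j. ((\<lambda>t. s' t $ j) \<longlongrightarrow> 0) at_top"
    by blast
  have "((\<lambda>t. (s t + s' t) $ j) \<longlongrightarrow> 0) at_top" for j
    using tendsto_add[OF spec[OF s(5)] spec[OF s(6)], of j j] by simp
  then show ?case
    using s by (intro exI[of _ "\<lambda>t. s t + s' t"]) (simp add: complex_solution_add)
qed

text \<open>Let \<open>d\<close> be least with \<open>(M - l)\<^sup>d w = 0\<close>. If \<open>d \<ge> 1\<close>, then \<open>(M - l)\<^bsup>d-1\<^esup> w\<close> is an eigenvector, whence
  \<open>Re l \<le> 0\<close>; if \<open>Re l = 0\<close>, then \<open>d \<ge> 2\<close> would give a Jordan chain of length two. So the orbit either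
  decays or is a constant vector times a factor of modulus one.\<close>
lemma bounded_solution:
  fixes M :: "complex^'n^'n"
  assumes eig: "\<And>l y. y \<noteq> 0 \<Longrightarrow> shifted M l y = 0 \<Longrightarrow> Re l \<le> 0"
    and chain: "\<And>l y. Re l = 0 \<Longrightarrow> shifted M l (shifted M l y) = 0 \<Longrightarrow> shifted M l y = 0"
  shows "\<exists>s. complex_solution M s \<and> s 0 = v \<and> (\<forall>j. bounded ((\<lambda>t. s t $ j) ` {0..}))"
proof (induction v rule: generalized_eigenvector_induct[where M = M])
  case (1 l m w)
  define d where "d = (LEAST m. (shifted M l ^^ m) w = 0)"
  have d: "(shifted M l ^^ d) w = 0"
    unfolding d_def using 1 by (rule LeastI)
  have least: "(shifted M l ^^ i) w \<noteq> 0" if "i < d" for i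
    using not_less_Least that unfolding d_def by blast
  have bdd: "bounded ((\<lambda>t. jordan_orbit M l d w t $ j) ` {0..})" for j
  proof (cases "Re l < 0")
    case True
    have "continuous_on UNIV (\<lambda>t. jordan_orbit M l d w t $ j)"
      using complex_solution_jordan_orbit[OF d] unfolding complex_solution_def
      by (auto intro!: continuous_at_imp_continuous_on has_vector_derivative_continuous)
    then show ?thesis
      using jordan_orbit_tendsto_0[OF True] by (rule bounded_on_halfline)
  next
    case False
    have "d \<le> 1"
    proof (rule ccontr)
      assume "\<not> d \<le> 1"
      then obtain i where i: "d = Suc (Suc i)"
        by (metis One_nat_def not0_implies_Suc le_SucI le_zero_eq not_less_eq_eq nat_le_linear)
      let ?y = "(shifted M l ^^ i) w"
      have y: "shifted M l (shifted M l ?y) = 0" "shifted M l ?y \<noteq> 0"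
        using d least[of "Suc i"] by (simp_all add: i)
      with eig False have "Re l = 0" by fastforce
      with chain y show False by blast
    qed
    moreover have "Re l = 0" if "d = 1"
      using eig[of w l] d least[of 0] that False by force
    ultimately show ?thesis
      by (cases d) (auto simp: jordan_orbit_def bounded_iff norm_mult)
  qed
  show ?case
  proof (cases d)
    case 0
    then have "w = 0" using d by simp
    then show ?thesis
      by (intro exI[of _ "\<lambda>_. 0"]) (auto simp: complex_solution_def bounded_iff)
  next
    case (Suc n)
    then show ?thesis
      using bdd complex_solution_jordan_orbit[OF d] jordan_orbit_0[of M l n w] by metis
  qed
next
  case (2 u w)
  then obtain s s' where s: "complex_solution M s" "s 0 = u" "complex_solution M s'" "s' 0 = w"
      "\<forall>j. bounded ((\<lambda>t. s t $ j) ` {0..})" "\<forall>j. bounded ((\<lambda>t. s' t $ j) ` {0..})"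
    by blast
  have "bounded ((\<lambda>t. (s t + s' t) $ j) ` {0..})" for j
    using s(5,6) bounded_plus_comp[of "\<lambda>t. s t $ j" "{0..}" "\<lambda>t. s' t $ j"] by simp
  then show ?case
    using s by (intro exI[of _ "\<lambda>t. s t + s' t"]) (simp add: complex_solution_add)
qed

section \<open>The adjoint system\<close>

text \<open>The pairing is bilinear, without conjugation, so that the transpose is its adjoint.\<close>
definition pairing :: "complex^'n \<Rightarrow> real^'n \<Rightarrow> complex" where
  "pairing y x = (\<Sum>j\<in>UNIV. y $ j * of_real (x $ j))"

definition adjoint_matrix :: "real^'n^'n \<Rightarrow> complex^'n^'n" where
  "adjoint_matrix A = (\<chi> i j. of_real (A $ j $ i))"

lemma pairing_adjoint: "pairing (adjoint_matrix A *v y) x = pairing y (A *v x)"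
proof -
  have "pairing (adjoint_matrix A *v y) x
      = (\<Sum>j\<in>UNIV. \<Sum>i\<in>UNIV. of_real (A$i$j) * y$i * of_real (x$j))"
    by (simp add: pairing_def adjoint_matrix_def matrix_vector_mult_def sum_distrib_right)
  also have "\<dots> = (\<Sum>i\<in>UNIV. \<Sum>j\<in>UNIV. of_real (A$i$j) * y$i * of_real (x$j))"
    by (rule sum.swap)
  also have "\<dots> = pairing y (A *v x)"
    by (simp add: pairing_def matrix_vector_mult_def sum_distrib_left algebra_simps)
  finally show ?thesis .
qed

text \<open>The function \<open>t \<mapsto> \<langle>s(T - t), r(t)\<rangle>\<close> has derivative \<open>-\<langle>A\<^sup>T s, r\<rangle> + \<langle>s, A r\<rangle> = 0\<close> on \<open>[0, T]\<close>;
  compare its values at both ends.\<close>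
lemma duality:
  assumes r: "lti_solution A r" and s: "complex_solution (adjoint_matrix A) s" and "T \<ge> 0"
  shows "pairing (s 0) (r T) = pairing (s T) (r 0)"
proof -
  let ?g = "\<lambda>t. pairing (s (T - t)) (r t)"
  have "(?g has_vector_derivative 0) (at t within {0..T})" if "t \<in> {0..T}" for t
  proof -
    have "((\<lambda>t. r t) has_vector_derivative A *v r t) (at t within {0..T})"
      using r that unfolding lti_solution_def
      by (auto intro: has_vector_derivative_within_subset)
    then have "((\<lambda>t. r t $ j) has_vector_derivative (A *v r t) $ j) (at t within {0..T})" for j
      by (rule bounded_linear.has_vector_derivative[OF bounded_linear_vec_nth])
    then have 1: "((\<lambda>t. complex_of_real (r t $ j)) has_vector_derivative of_real ((A *v r t) $ j))
        (at t within {0..T})" for j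
      by (intro has_vector_derivative_of_real)
         (simp add: has_real_derivative_iff_has_vector_derivative)
    have "((\<lambda>t. s (T - t) $ j) has_vector_derivative - ((adjoint_matrix A *v s (T - t)) $ j))
        (at t within {0..T})" for j
    proof -
      have "((\<lambda>t. T - t) has_vector_derivative - 1) (at t)"
        by (auto intro!: derivative_eq_intros)
      moreover have "((\<lambda>t. s t $ j) has_vector_derivative (adjoint_matrix A *v s (T - t)) $ j) (at (T - t))"
        using s by (simp add: complex_solution_def)
      ultimately show ?thesis
        using vector_diff_chain_at[of "\<lambda>t. T - t" "-1" t "\<lambda>t. s t $ j"]
        by (auto simp: o_def intro: has_vector_derivative_at_within)
    qed
    then have "(?g has_vector_derivative (\<Sum>j\<in>UNIV. s (T - t) $ j * of_real ((A *v r t) $ j)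
        + - ((adjoint_matrix A *v s (T - t)) $ j) * of_real (r t $ j))) (at t within {0..T})"
      unfolding pairing_def using 1
      by (intro has_vector_derivative_sum has_vector_derivative_mult)
    also have "(\<Sum>j\<in>UNIV. s (T - t) $ j * of_real ((A *v r t) $ j)
        + - ((adjoint_matrix A *v s (T - t)) $ j) * of_real (r t $ j))
        = pairing (s (T - t)) (A *v r t) - pairing (adjoint_matrix A *v s (T - t)) (r t)"
      by (simp add: pairing_def sum_subtractf)
    finally show ?thesis
      by (simp add: pairing_adjoint)
  qed
  then have "\<exists>c. \<forall>t\<in>{0..T}. ?g t = c"
    by (intro has_derivative_zero_constant) (auto simp: has_vector_derivative_def)
  then obtain c where "\<forall>t\<in>{0..T}. ?g t = c" ..
  then have "?g T = ?g 0"
    using \<open>T \<ge> 0\<close> by (metis atLeastAtMost_iff order_refl)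
  then show ?thesis by simp
qed

lemma pairing_axis [simp]: "pairing (axis i 1) x = of_real (x $ i)"
  by (simp add: pairing_def axis_def if_distrib[of "\<lambda>a. a * _"] cong: if_cong)

lemma pairing_add: "pairing (y + z) x = pairing y x + pairing z x"
  by (simp add: pairing_def sum.distrib algebra_simps)

lemma pairing_scale: "pairing (c *s y) x = c * pairing y x"
  by (simp add: pairing_def sum_distrib_left algebra_simps)

lemma norm_pairing_le: "norm (pairing y x) \<le> (\<Sum>j\<in>UNIV. norm (y $ j)) * norm x"
  unfolding pairing_def sum_distrib_right
  by (intro sum_norm_le) (simp add: norm_mult mult_left_mono component_le_norm_cart)

lemma norm_ge_pairing:
  obtains K where "K > 0" "\<And>x. norm x \<ge> K * norm (pairing y x)"
proof
  let ?S = "(\<Sum>j\<in>UNIV. norm (y $ j)) + 1"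
  have "?S > 0" by (simp add: add_nonneg_pos sum_nonneg)
  then show "1 / ?S > 0" by simp
  fix x
  have "norm (pairing y x) \<le> ?S * norm x"
    using norm_pairing_le[of y x] by (simp add: distrib_right add_increasing2)
  then show "norm x \<ge> 1 / ?S * norm (pairing y x)"
    using \<open>?S > 0\<close> by (simp add: divide_le_eq mult.commute)
qed

section \<open>Spectral criteria for stability\<close>

text \<open>By duality with the adjoint solution \<open>s\<close> through a unit vector, \<open>r\<^sub>i(t) = \<langle>s(t), r(0)\<rangle>\<close>. A bound
  for the finitely many such \<open>s\<close> is therefore a bound for \<open>|r(t)| / |r(0)|\<close>, the same for every
  solution \<open>r\<close>.\<close>
lemma zero_stable_if_adjoint_spectrum:
  fixes A :: "real^'n^'n"
  assumes "\<And>l y. y \<noteq> 0 \<Longrightarrow> shifted (adjoint_matrix A) l y = 0 \<Longrightarrow> Re l \<le> 0"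
    and "\<And>l y. Re l = 0 \<Longrightarrow> shifted (adjoint_matrix A) l (shifted (adjoint_matrix A) l y) = 0 \<Longrightarrow>
            shifted (adjoint_matrix A) l y = 0"
  shows "zero_stable A"
proof -
  have "\<exists>b. \<forall>r t. lti_solution A r \<longrightarrow> t \<ge> 0 \<longrightarrow> \<bar>r t $ i\<bar> \<le> b * norm (r 0)" for i
  proof -
    obtain s where s: "complex_solution (adjoint_matrix A) s" "s 0 = axis i 1"
        "\<And>j. bounded ((\<lambda>t. s t $ j) ` {0..})"
      using bounded_solution[of "adjoint_matrix A" "axis i 1"] assms by blast
    have "\<forall>j. \<exists>c. \<forall>t\<ge>0. norm (s t $ j) \<le> c"
      using s(3) by (fastforce simp: bounded_iff)
    then obtain c where c: "\<And>j t. t \<ge> 0 \<Longrightarrow> norm (s t $ j) \<le> c j"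
      by metis
    have "\<bar>r t $ i\<bar> \<le> (\<Sum>j\<in>UNIV. c j) * norm (r 0)" if "lti_solution A r" "t \<ge> 0" for r t
    proof -
      have "\<bar>r t $ i\<bar> = norm (pairing (s t) (r 0))"
        using duality[OF that(1) s(1) that(2)] by (metis s(2) pairing_axis norm_of_real)
      also have "\<dots> \<le> (\<Sum>j\<in>UNIV. norm (s t $ j)) * norm (r 0)"
        by (rule norm_pairing_le)
      also have "\<dots> \<le> (\<Sum>j\<in>UNIV. c j) * norm (r 0)"
        using c that(2) by (intro mult_right_mono sum_mono) auto
      finally show ?thesis .
    qed
    then show ?thesis by blast
  qed
  then obtain b where b: "\<And>i r t. lti_solution A r \<Longrightarrow> t \<ge> 0 \<Longrightarrow> \<bar>r t $ i\<bar> \<le> b i * norm (r 0)"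
    by metis
  define K where "K = \<bar>\<Sum>i\<in>UNIV. b i\<bar> + 1"
  have K: "norm (r t) \<le> K * norm (r 0)" if "lti_solution A r" "t \<ge> 0" for r t
  proof -
    have "norm (r t) \<le> (\<Sum>i\<in>UNIV. \<bar>r t $ i\<bar>)"
      by (rule norm_le_l1_cart)
    also have "\<dots> \<le> (\<Sum>i\<in>UNIV. b i) * norm (r 0)"
      unfolding sum_distrib_right using b[OF that] by (rule sum_mono)
    also have "\<dots> \<le> K * norm (r 0)"
      by (intro mult_right_mono) (auto simp: K_def)
    finally show ?thesis .
  qed
  have "K > 0" by (simp add: K_def add_nonneg_pos)
  show ?thesis
    unfolding zero_stable_def
  proof (intro allI impI)
    fix \<epsilon> :: real assume "\<epsilon> > 0"
    show "\<exists>\<delta>>0. \<forall>r. lti_solution A r \<and> norm (r 0) < \<delta> \<longrightarrow> (\<forall>t\<ge>0. norm (r t) < \<epsilon>)"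
    proof (intro exI[of _ "\<epsilon> / K"] conjI allI impI)
      fix r and t :: real assume r: "lti_solution A r \<and> norm (r 0) < \<epsilon> / K" and "t \<ge> 0"
      then have "norm (r t) \<le> K * norm (r 0)" using K by blast
      also have "\<dots> < \<epsilon>" using r \<open>K > 0\<close> by (simp add: pos_less_divide_eq mult.commute)
      finally show "norm (r t) < \<epsilon>" .
    qed (use \<open>K > 0\<close> \<open>\<epsilon> > 0\<close> in simp)
  qed
qed

lemma zero_asymptotically_stable_if_adjoint_spectrum:
  fixes A :: "real^'n^'n"
  assumes "\<And>l y. y \<noteq> 0 \<Longrightarrow> shifted (adjoint_matrix A) l y = 0 \<Longrightarrow> Re l < 0"
  shows "zero_asymptotically_stable A"
proof -
  have "zero_stable A"
  proof (rule zero_stable_if_adjoint_spectrum)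
    show "Re l \<le> 0" if "y \<noteq> 0" "shifted (adjoint_matrix A) l y = 0" for l y
      using assms[OF that] by simp
    show "shifted (adjoint_matrix A) l y = 0"
      if "Re l = 0" "shifted (adjoint_matrix A) l (shifted (adjoint_matrix A) l y) = 0" for l y
      using assms[of "shifted (adjoint_matrix A) l y" l] that by auto
  qed
  moreover have "(r \<longlongrightarrow> 0) at_top" if r: "lti_solution A r" for r
  proof (rule vec_tendstoI)
    fix i
    obtain s where s: "complex_solution (adjoint_matrix A) s" "s 0 = axis i 1"
        "\<And>j. ((\<lambda>t. s t $ j) \<longlongrightarrow> 0) at_top"
      using decaying_solution[of "adjoint_matrix A" "axis i 1"] assms by blast
    have "((\<lambda>t. pairing (s t) (r 0)) \<longlongrightarrow> 0) at_top"
      unfolding pairing_def by (intro tendsto_null_sum tendsto_mult_left_zero s(3))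
    then have "((\<lambda>t. Re (pairing (s t) (r 0))) \<longlongrightarrow> 0) at_top"
      by (auto dest: tendsto_Re)
    moreover have "\<forall>\<^sub>F t in at_top. Re (pairing (s t) (r 0)) = r t $ i"
      using eventually_ge_at_top[of 0]
      by eventually_elim (metis duality[OF r s(1)] s(2) pairing_axis Re_complex_of_real)
    ultimately show "((\<lambda>t. r t $ i) \<longlongrightarrow> 0 $ i) at_top"
      by (simp add: Lim_transform_eventually)
  qed
  ultimately show ?thesis
    unfolding zero_asymptotically_stable_def by (metis zero_less_one)
qed

section \<open>Growth of generic solutions\<close>

lemma pairing_eigenvector:
  assumes "lti_solution A r" "t \<ge> 0" "shifted (adjoint_matrix A) l y = 0"
  shows "pairing y (r t) = exp (l * of_real t) * pairing y (r 0)"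
  using duality[OF assms(1) complex_solution_jordan_orbit[where M = "adjoint_matrix A" and l = l
      and m = "Suc 0" and w = y] assms(2)] assms(3)
  unfolding jordan_orbit_0 by (simp add: jordan_orbit_def pairing_scale)

lemma pairing_chain:
  assumes "lti_solution A r" "t \<ge> 0"
    "shifted (adjoint_matrix A) l (shifted (adjoint_matrix A) l y) = 0"
  shows "pairing y (r t) = exp (l * of_real t)
           * (pairing y (r 0) + of_real t * pairing (shifted (adjoint_matrix A) l y) (r 0))"
proof -
  have "complex_solution (adjoint_matrix A) (jordan_orbit (adjoint_matrix A) l (Suc (Suc 0)) y)"
    by (rule complex_solution_jordan_orbit) (use assms(3) in simp)
  from duality[OF assms(1) this assms(2)] show ?thesis
    unfolding jordan_orbit_0 by (simp add: jordan_orbit_def pairing_scale pairing_add algebra_simps)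
qed

lemma norm_at_top_if_pairing:
  assumes "filterlim (\<lambda>t. norm (pairing y (r t))) at_top at_top"
  shows "filterlim (\<lambda>t. norm (r t)) at_top at_top"
proof -
  obtain K where K: "K > 0" "\<And>x. norm x \<ge> K * norm (pairing y x)"
    using norm_ge_pairing[of y] by blast
  have "filterlim (\<lambda>t. K * norm (pairing y (r t))) at_top at_top"
    using K(1) assms by (intro filterlim_tendsto_pos_mult_at_top[OF tendsto_const])
  then show ?thesis
    by (rule filterlim_at_top_mono) (use K(2) in simp)
qed

text \<open>Instability yields, for the transpose, an eigenvector with \<open>Re l > 0\<close>, along which solutions grow
  exponentially, or a Jordan chain with \<open>Re l = 0\<close>, along which they grow linearly. In the second case
  the growth rate is the pairing of \<open>r(0)\<close> with the eigenvector at the end of the chain, which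
  therefore serves as the witness.\<close>
lemma unstable_imp_generic_escape:
  fixes A :: "real^'n^'n"
  assumes "\<not> zero_stable A"
  obtains y where "y \<noteq> 0"
    "\<forall>r. lti_solution A r \<and> pairing y (r 0) \<noteq> 0 \<longrightarrow> filterlim (\<lambda>t. norm (r t)) at_top at_top"
proof -
  let ?S = "shifted (adjoint_matrix A)"
  consider l y where "y \<noteq> 0" "?S l y = 0" "Re l > 0"
    | l y where "Re l = 0" "?S l (?S l y) = 0" "?S l y \<noteq> 0"
    using assms zero_stable_if_adjoint_spectrum[of A] by (meson not_le)
  then show thesis
  proof cases
    case (1 l y)
    have "filterlim (\<lambda>t. norm (r t)) at_top at_top"
      if r: "lti_solution A r" "pairing y (r 0) \<noteq> 0" for r
    proof (rule norm_at_top_if_pairing)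
      have "filterlim (\<lambda>t. Re l * t) at_top at_top"
        using 1 by (intro filterlim_tendsto_pos_mult_at_top[OF tendsto_const] filterlim_ident)
      from filterlim_compose[OF exp_at_top this]
      have "filterlim (\<lambda>t. norm (pairing y (r 0)) * exp (Re l * t)) at_top at_top"
        using r by (intro filterlim_tendsto_pos_mult_at_top[OF tendsto_const]) auto
      then show "filterlim (\<lambda>t. norm (pairing y (r t))) at_top at_top"
      proof (rule filterlim_at_top_mono)
        show "\<forall>\<^sub>F t in at_top. norm (pairing y (r 0)) * exp (Re l * t) \<le> norm (pairing y (r t))"
          using eventually_ge_at_top[of 0]
        proof eventually_elim
          case (elim t)
          show ?case
            by (simp add: pairing_eigenvector[OF r(1) elim 1(2)] norm_mult)
        qed
      qed
    qed
    then show thesis using that[of y] 1(1) by blast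
  next
    case (2 l y)
    have "filterlim (\<lambda>t. norm (r t)) at_top at_top"
      if r: "lti_solution A r" "pairing (?S l y) (r 0) \<noteq> 0" for r
    proof (rule norm_at_top_if_pairing)
      have "filterlim (\<lambda>t. - norm (pairing y (r 0)) + norm (pairing (?S l y) (r 0)) * t) at_top at_top"
        using r by (intro filterlim_tendsto_add_at_top[OF tendsto_const]
            filterlim_tendsto_pos_mult_at_top[OF tendsto_const] filterlim_ident) auto
      then show "filterlim (\<lambda>t. norm (pairing y (r t))) at_top at_top"
      proof (rule filterlim_at_top_mono)
        show "\<forall>\<^sub>F t in at_top. - norm (pairing y (r 0)) + norm (pairing (?S l y) (r 0)) * t
            \<le> norm (pairing y (r t))"
          using eventually_ge_at_top[of 0]
        proof eventually_elim
          case (elim t)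
          have "norm (pairing y (r t)) = norm (of_real t * pairing (?S l y) (r 0) + pairing y (r 0))"
            by (simp add: pairing_chain[OF r(1) elim 2(2)] norm_mult 2(1) add.commute)
          also have "\<dots> \<ge> norm (of_real t * pairing (?S l y) (r 0)) - norm (pairing y (r 0))"
            by (rule norm_diff_ineq)
          finally show ?case
            using elim by (simp add: norm_mult mult.commute)
        qed
      qed
    qed
    then show thesis using that[of "?S l y"] 2(3) by blast
  qed
qed

text \<open>Some eigenvector \<open>y\<close> of the transpose belongs to an eigenvalue with \<open>Re l \<ge> 0\<close>, and then
  \<open>|\<langle>y, r(t)\<rangle>|\<close> never falls below its initial value.\<close>
lemma not_asymptotically_stable_imp_generic_lower_bound:
  fixes A :: "real^'n^'n"
  assumes "\<not> zero_asymptotically_stable A"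
  obtains y where "y \<noteq> 0"
    "\<forall>r. lti_solution A r \<and> pairing y (r 0) \<noteq> 0 \<longrightarrow> (\<exists>c>0. \<forall>t\<ge>0. norm (r t) \<ge> c)"
proof -
  obtain l y where y: "y \<noteq> 0" "shifted (adjoint_matrix A) l y = 0" "Re l \<ge> 0"
    using assms zero_asymptotically_stable_if_adjoint_spectrum[of A] by (meson not_le)
  obtain K where K: "K > 0" "\<And>x. norm x \<ge> K * norm (pairing y x)"
    using norm_ge_pairing[of y] by blast
  have "\<exists>c>0. \<forall>t\<ge>0. norm (r t) \<ge> c" if r: "lti_solution A r" "pairing y (r 0) \<noteq> 0" for r
  proof (intro exI[of _ "K * norm (pairing y (r 0))"] conjI allI impI)
    fix t :: real assume "t \<ge> 0"
    then have "1 * norm (pairing y (r 0)) \<le> exp (Re l * t) * norm (pairing y (r 0))"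
      using y(3) by (intro mult_right_mono) simp_all
    then have "norm (pairing y (r 0)) \<le> norm (pairing y (r t))"
      by (simp add: pairing_eigenvector[OF r(1) \<open>t \<ge> 0\<close> y(2)] norm_mult)
    then show "K * norm (pairing y (r 0)) \<le> norm (r t)"
      using K by (meson mult_left_mono less_imp_le order_trans)
  qed (use K r in simp)
  then show thesis using that[of y] y(1) by blast
qed

text \<open>The kernel lies in the real hyperplane orthogonal to the real part or to the imaginary part of
  \<open>y\<close>, whichever is nonzero.\<close>
lemma negligible_pairing_kernel:
  fixes y :: "complex^'n"
  assumes "y \<noteq> 0"
  shows "negligible {x. pairing y x = 0}"
proof -
  define a b where "a = (\<chi> j. Re (y $ j))" and "b = (\<chi> j. Im (y $ j))"
  have ker: "a \<bullet> x = 0 \<and> b \<bullet> x = 0" if "pairing y x = 0" for x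
  proof -
    have "Re (pairing y x) = a \<bullet> x" "Im (pairing y x) = b \<bullet> x"
      by (simp_all add: pairing_def a_def b_def inner_vec_def)
    then show ?thesis using that by simp
  qed
  have "a \<noteq> 0 \<or> b \<noteq> 0"
    using assms by (auto simp: a_def b_def vec_eq_iff complex_eq_iff)
  then show ?thesis
  proof
    assume "a \<noteq> 0"
    then have "negligible {x. a \<bullet> x = 0}" by (simp add: negligible_hyperplane)
    then show ?thesis by (rule negligible_subset) (use ker in auto)
  next
    assume "b \<noteq> 0"
    then have "negligible {x. b \<bullet> x = 0}" by (simp add: negligible_hyperplane)
    then show ?thesis by (rule negligible_subset) (use ker in auto)
  qed
qed

lemma solution_with_generic_start:
  fixes A :: "real^'n^'n"
  assumes "E \<in> sets lebesgue" "emeasure lebesgue E > 0" "y \<noteq> 0"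
  obtains r where "lti_solution A r" "r 0 \<in> E" "pairing y (r 0) \<noteq> 0"
proof -
  have "\<not> E \<subseteq> {x. pairing y x = 0}"
  proof
    assume "E \<subseteq> {x. pairing y x = 0}"
    then have "negligible E"
      using negligible_pairing_kernel[OF assms(3)] negligible_subset by blast
    then show False
      using assms(1,2) by (simp add: negligible_iff_null_sets null_setsD1)
  qed
  then obtain x where "x \<in> E" "pairing y x \<noteq> 0" by blast
  moreover obtain r where "lti_solution A r" "r 0 = x"
    by (rule lti_solution_through)
  ultimately show thesis using that by blast
qed

section \<open>Torsion and stability\<close>

theorem theorem1p2:
  fixes A :: "real^'n::{finite,linorder}^'n::{finite,linorder}"
  assumes "invertible A"
  shows "((\<exists>E1. E1 \<in> sets lebesgue \<and> emeasure lebesgue E1 > 0 \<and>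
             (\<forall>r. lti_solution A r \<and> r 0 \<in> E1 \<longrightarrow> \<not> (torsion r \<longlongrightarrow> 0) at_top))
           \<longrightarrow> zero_stable A) \<and>
         ((\<exists>E2. E2 \<in> sets lebesgue \<and> emeasure lebesgue E2 > 0 \<and>
             (\<forall>r. lti_solution A r \<and> r 0 \<in> E2 \<longrightarrow> filterlim (torsion r) at_top at_top))
           \<longrightarrow> zero_asymptotically_stable A)"
proof (intro conjI impI; elim exE conjE)
  obtain C where C: "\<And>r t. lti_solution A r \<Longrightarrow> t \<ge> 0 \<Longrightarrow> torsion r t * norm (r t) \<le> C"
    using torsion_times_norm_bounded[OF assms] by blast
  show "zero_stable A"
    if E: "E \<in> sets lebesgue" "emeasure lebesgue E > 0"
      and no_limit: "\<forall>r. lti_solution A r \<and> r 0 \<in> E \<longrightarrow> \<not> (torsion r \<longlongrightarrow> 0) at_top"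
    for E
  proof (rule ccontr)
    assume "\<not> zero_stable A"
    then obtain y where y: "y \<noteq> 0"
      "\<forall>r. lti_solution A r \<and> pairing y (r 0) \<noteq> 0 \<longrightarrow> filterlim (\<lambda>t. norm (r t)) at_top at_top"
      by (rule unstable_imp_generic_escape)
    obtain r where r: "lti_solution A r" "r 0 \<in> E" "pairing y (r 0) \<noteq> 0"
      using solution_with_generic_start[OF E y(1)] by blast
    have lim: "filterlim (\<lambda>t. norm (r t)) at_top at_top"
      using y(2) r by blast
    have quotient: "((\<lambda>t. C / norm (r t)) \<longlongrightarrow> 0) at_top"
      using lim by (intro real_tendsto_divide_at_top[OF tendsto_const])
    have upper: "\<forall>\<^sub>F t in at_top. torsion r t \<le> C / norm (r t)"
      using eventually_ge_at_top[of 0] filterlim_at_top_dense[THEN iffD1, OF lim, THEN spec, of 0]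
      by eventually_elim (use C[OF r(1)] in \<open>simp add: le_divide_eq\<close>)
    have lower: "\<forall>\<^sub>F t in at_top. 0 \<le> torsion r t"
      by (simp add: torsion_nonneg)
    have "(torsion r \<longlongrightarrow> 0) at_top"
      by (rule tendsto_sandwich[OF lower upper tendsto_const quotient])
    then show False using no_limit r by blast
  qed
  show "zero_asymptotically_stable A"
    if E: "E \<in> sets lebesgue" "emeasure lebesgue E > 0"
      and blow_up: "\<forall>r. lti_solution A r \<and> r 0 \<in> E \<longrightarrow> filterlim (torsion r) at_top at_top"
    for E
  proof (rule ccontr)
    assume "\<not> zero_asymptotically_stable A"
    then obtain y where y: "y \<noteq> 0"
      "\<forall>r. lti_solution A r \<and> pairing y (r 0) \<noteq> 0 \<longrightarrow> (\<exists>c>0. \<forall>t\<ge>0. norm (r t) \<ge> c)"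
      by (rule not_asymptotically_stable_imp_generic_lower_bound)
    obtain r where r: "lti_solution A r" "r 0 \<in> E" "pairing y (r 0) \<noteq> 0"
      using solution_with_generic_start[OF E y(1)] by blast
    then obtain c where c: "c > 0" "\<And>t. t \<ge> 0 \<Longrightarrow> norm (r t) \<ge> c"
      using y(2) by blast
    have bound: "torsion r t \<le> C / c" if "t \<ge> 0" for t
    proof -
      have "torsion r t * c \<le> torsion r t * norm (r t)"
        using c(2)[OF that] by (intro mult_left_mono torsion_nonneg)
      also have "\<dots> \<le> C" using C[OF r(1) that] .
      finally show ?thesis using c(1) by (simp add: le_divide_eq)
    qed
    have "filterlim (torsion r) at_top at_top"
      using blow_up r by blast
    then have "\<forall>\<^sub>F t in at_top. torsion r t > C / c"
      by (simp add: filterlim_at_top_dense)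
    with eventually_ge_at_top[of 0] have "\<forall>\<^sub>F t in at_top. 0 \<le> t \<and> C / c < torsion r t"
      by (rule eventually_conj)
    then obtain t where "t \<ge> 0" "torsion r t > C / c"
      using eventually_happens'[OF trivial_limit_at_top_linorder] by blast
    with bound show False by fastforce
  qed
qed

end
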